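(* Let $J\in\mathcal{P}$. Suppose $(P_J)$ has a (global) optimizer $(u_J,v_J)$ that is feasible for the bilevel problem, i.e., $(u_J,v_J)\in\mathcal{F}$. (i) If $\vartheta_J\le\vartheta_{J'}$ for every $J'\in\mathcal{P}$ such that $J'\subseteq\mathcal{I}(u_J,v_J)\cup J$, then $(u_J,v_J)$ is a local optimizer of the bilevel problem. (ii) If $\vartheta_J\le\vartheta_{J'}$ for all $J'\in\mathcal{P}$, then $(u_J,v_J)$ is a global optimizer of the bilevel problem.
   Context: Let $n,p,m$ be positive integers, $[m]=\{1,\dots,m\}$, and let $\mathcal{I}_1$ be a finite (possibly empty) index set. Let $F,f,h_i$ ($i\in\mathcal{I}_1$) be real polynomials in $(x,y)\in\mathbb{R}^n\times\mathbb{R}^p$, let $a_1,\dots,a_m\in\mathbb{R}^p$ be constant vectors and $b_1,\dots,b_m$ real polynomials in $x\in\mathbb{R}^n$. Let $A\in\mathbb{R}^{m\times p}$ be the matrix with rows $a_1^T,\dots,a_m^T$, $b(x)=(b_1(x),\dots,b_m(x))^T$, and $t=\operatorname{rank}A$. For $x\in\mathbb{R}^n$ let $Z(x)=\{y\in\mathbb{R}^p : Ay-b(x)\ge 0\}$ and let $S(x)$ be the set of global minimizers of $f(x,\cdot)$ over $Z(x)$. Put $$\mathcal{U}=\{(x,y) : h_i(x,y)\ge 0\ (i\in\mathcal{I}_1),\ a_j^Ty-b_j(x)\ge 0\ (j\in[m])\},\qquad \mathcal{F}=\{(x,y)\in\mathcal{U} : y\in S(x)\}.$$ The bilevel problem is: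 minimize $F(x,y)$ over $(x,y)\in\mathcal{F}$. A point of $\mathcal{F}$ is a global (resp. local) optimizer if it minimizes $F$ over $\mathcal{F}$ (resp. over $\mathcal{F}\cap B$ for some ball $B$ of positive radius centered at the point). Standing assumption: $S(x)\neq\emptyset$ for every $x$ such that $(x,y)\in\mathcal{U}$ for some $y$. For $J\subseteq[m]$, $A_J$ denotes the submatrix of $A$ with rows $a_j^T$, $j\in J$. Let $\mathcal{P}=\{J\subseteq[m] : |J|=t,\ A_J\text{ has full rank}\}$. For $J\in\mathcal{P}$, $\mathcal{K}_J$ is the set of all $(x,y)\in\mathcal{U}$ for which there exists $\lambda_J=(\lambda_j)_{j\in J}$ with $\nabla_yf(x,y)-A_J^T\lambda_J=0$ and, for all $j\in J$, $a_j^Ty-b_j(x)\ge0$, $\lambda_j\ge0$, $\lambda_j\,(a_j^Ty-b_j(x))=0$. For $J\in\mathcal{P}$, the branch problem $(P_J)$ is: minimize $F(x,y)$ over $(x,y)\in\mathcal{K}_J$; $\vartheta_J$ denotes its optimal value (infimum, equal to $+\infty$ if $\mathcal{K}_J=\emptyset$). The active index set at $(x,y)$ is $\mathcal{I}(x,y)=\{j\in[m] : a_j^Ty=b_j(x)\}$. *)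

theory Defs
  imports "HOL-Analysis.Analysis"
begin

text \<open>
  Dimensions are types: \<open>'n\<close>, \<open>'p\<close> for the variables \<open>x\<close>, \<open>y\<close>, and \<open>'m\<close> for the index set of the
  lower-level constraints. The vectors \<open>a\<^sub>j\<close> are the rows of \<open>A\<close>. The inequality in \<open>lower_feasible\<close>
  is the componentwise order on vectors.
\<close>

definition lower_feasible :: "real^'p^'m \<Rightarrow> (real^'n \<Rightarrow> real^'m) \<Rightarrow> real^'n \<Rightarrow> (real^'p) set" where
  "lower_feasible A b x = {y. A *v y - b x \<ge> 0}"

definition lower_solutions ::
    "((real^'n) \<times> (real^'p) \<Rightarrow> real) \<Rightarrow> real^'p^'m \<Rightarrow> (real^'n \<Rightarrow> real^'m) \<Rightarrow> real^'n \<Rightarrow> (real^'p) set" where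
  "lower_solutions f A b x =
     {y. is_arg_min (\<lambda>v. f (x, v)) (\<lambda>v. v \<in> lower_feasible A b x) y}"

definition constraint_set ::
    "'i set \<Rightarrow> ('i \<Rightarrow> (real^'n) \<times> (real^'p) \<Rightarrow> real) \<Rightarrow> real^'p^'m \<Rightarrow> (real^'n \<Rightarrow> real^'m)
      \<Rightarrow> ((real^'n) \<times> (real^'p)) set" where
  "constraint_set I1 h A b =
     {(x, y). (\<forall>i\<in>I1. h i (x, y) \<ge> 0) \<and> (\<forall>j. row j A \<bullet> y - b x $ j \<ge> 0)}"

definition bilevel_feasible ::
    "'i set \<Rightarrow> ('i \<Rightarrow> (real^'n) \<times> (real^'p) \<Rightarrow> real) \<Rightarrow> ((real^'n) \<times> (real^'p) \<Rightarrow> real) \<Rightarrow> real^'p^'m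
      \<Rightarrow> (real^'n \<Rightarrow> real^'m) \<Rightarrow> ((real^'n) \<times> (real^'p)) set" where
  "bilevel_feasible I1 h f A b =
     {(x, y). (x, y) \<in> constraint_set I1 h A b \<and> y \<in> lower_solutions f A b x}"

definition global_optimizer :: "('z \<Rightarrow> real) \<Rightarrow> 'z set \<Rightarrow> 'z \<Rightarrow> bool" where
  "global_optimizer F S z \<longleftrightarrow> is_arg_min F (\<lambda>w. w \<in> S) z"

definition local_optimizer :: "('z::metric_space \<Rightarrow> real) \<Rightarrow> 'z set \<Rightarrow> 'z \<Rightarrow> bool" where
  "local_optimizer F S z \<longleftrightarrow> (\<exists>r>0. global_optimizer F (S \<inter> ball z r) z)"

text \<open>
  The submatrix \<open>A\<^sub>J\<close> has an index-dependent number of rows, so it is not formed as a matrix; its rank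
  is the dimension of its set of rows, in line with the definition of \<^const>\<open>rank\<close>.
\<close>

definition row_submatrix_rank :: "real^'p^'m \<Rightarrow> 'm set \<Rightarrow> nat" where
  "row_submatrix_rank A J = dim {row j A |j. j \<in> J}"

definition row_bases :: "real^'p^'m \<Rightarrow> 'm set set" where
  "row_bases A =
     {J. card J = rank A \<and> row_submatrix_rank A J = min (card J) CARD('p)}"

text \<open>
  The gradient in \<open>y\<close>; the description is well-defined whenever \<open>f(x, \<cdot>)\<close> is differentiable at \<open>y\<close>,
  in particular for polynomials.
\<close>

definition grad_y :: "((real^'n) \<times> (real^'p) \<Rightarrow> real) \<Rightarrow> real^'n \<Rightarrow> real^'p \<Rightarrow> real^'p" where
  "grad_y f x y = (THE D. GDERIV (\<lambda>v. f (x, v)) y :> D)"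

text \<open>
  In \<open>branch_set\<close> the multiplier \<open>l\<close> is a total function of which only the values on \<open>J\<close> are used;
  the sum is \<open>A\<^sub>J\<^sup>T \<lambda>\<^sub>J\<close>.
\<close>

definition branch_set ::
    "'i set \<Rightarrow> ('i \<Rightarrow> (real^'n) \<times> (real^'p) \<Rightarrow> real) \<Rightarrow> ((real^'n) \<times> (real^'p) \<Rightarrow> real) \<Rightarrow> real^'p^'m
      \<Rightarrow> (real^'n \<Rightarrow> real^'m) \<Rightarrow> 'm set \<Rightarrow> ((real^'n) \<times> (real^'p)) set" where
  "branch_set I1 h f A b J =
     {(x, y). (x, y) \<in> constraint_set I1 h A b \<and>
        (\<exists>l :: 'm \<Rightarrow> real.
           grad_y f x y - (\<Sum>j\<in>J. l j *\<^sub>R row j A) = 0 \<and>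
           (\<forall>j\<in>J. row j A \<bullet> y - b x $ j \<ge> 0 \<and> l j \<ge> 0 \<and>
                   l j * (row j A \<bullet> y - b x $ j) = 0))}"

definition branch_value ::
    "((real^'n) \<times> (real^'p) \<Rightarrow> real) \<Rightarrow> 'i set \<Rightarrow> ('i \<Rightarrow> (real^'n) \<times> (real^'p) \<Rightarrow> real)
      \<Rightarrow> ((real^'n) \<times> (real^'p) \<Rightarrow> real) \<Rightarrow> real^'p^'m \<Rightarrow> (real^'n \<Rightarrow> real^'m) \<Rightarrow> 'm set \<Rightarrow> ereal" where
  "branch_value F I1 h f A b J = (INF z\<in>branch_set I1 h f A b J. ereal (F z))"

definition active_set ::
    "real^'p^'m \<Rightarrow> (real^'n \<Rightarrow> real^'m) \<Rightarrow> real^'n \<Rightarrow> real^'p \<Rightarrow> 'm set" where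
  "active_set A b x y = {j. row j A \<bullet> y = b x $ j}"

end

theory Submission
  imports Defs
begin

text \<open>
  The point is that every bilevel feasible \<open>(x, y)\<close> lies in some branch set, and that the branch can
  be steered. Since the lower-level constraints are affine in \<open>y\<close>, a lower-level minimizer satisfies
  the KKT conditions: the gradient of \<open>f(x, \<cdot>)\<close> lies in
  the cone spanned by the active rows, because otherwise a hyperplane separating it from this closed
  cone yields a feasible descent direction (\<open>gradient_in_active_cone\<close>). By the conic form of
  Caratheodory's theorem (\<open>convex_cone_hull_caratheodory\<close>), linearly independent active rows suffice.
  They extend to a basis of the row space, chosen from any prescribed index set \<open>K\<close> that
  contains the active indices and whose rows span the row space; the additional multipliers are zero,
  so complementarity persists. Hence \<open>(x, y)\<close> lies in the branch set of some \<open>J' \<subseteq> K\<close>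
  (\<open>bilevel_feasible_in_branch\<close>).

  The global statement takes for \<open>K\<close> the set of all indices. For the local one, inactive constraints
  stay inactive near \<open>(u, v)\<close>, so that all nearby points have their active indices in
  \<open>K = active_set A b u v \<union> J\<close>, and \<open>J\<close> makes the rows of \<open>K\<close> span. In both cases the value of \<open>F\<close>
  at a feasible point is at least the value of its branch, and thus at least \<open>F (u, v)\<close>.
\<close>

section \<open>Conic Caratheodory theorem\<close>

lemma convex_cone_hull_finite_sum:
  fixes S :: "'a::real_vector set"
  assumes "finite S" "x \<in> convex_cone hull S"
  obtains c where "\<And>s. s \<in> S \<Longrightarrow> 0 \<le> c s" "x = (\<Sum>s\<in>S. c s *\<^sub>R s)"
proof -
  consider "x = 0" | y k where "y \<in> convex hull S" "0 \<le> k" "x = k *\<^sub>R y"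
    using assms(2) unfolding convex_cone_hull_convex_hull by auto
  then show ?thesis
  proof cases
    case 1
    then show ?thesis using that[of "\<lambda>_. 0"] by simp
  next
    case 2
    then obtain c where "\<forall>s\<in>S. 0 \<le> c s" "y = (\<Sum>s\<in>S. c s *\<^sub>R s)"
      unfolding convex_hull_finite[OF assms(1)] by blast
    with 2 show ?thesis
      by (intro that[of "\<lambda>s. k * c s"]) (simp_all add: scaleR_sum_right)
  qed
qed

text \<open>
  A linear relation among the vectors of a nonnegative combination can be subtracted from the
  coefficients until the first of them vanishes, so a combination with the fewest vectors uses linearly
  independent ones.
\<close>

lemma convex_cone_hull_caratheodory:
  fixes S :: "'a::real_vector set"
  assumes "finite S" "x \<in> convex_cone hull S"
  obtains T c where "T \<subseteq> S" "independent T" "\<And>t. t \<in> T \<Longrightarrow> 0 \<le> c t" "x = (\<Sum>t\<in>T. c t *\<^sub>R t)"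
proof -
  define P where "P T \<longleftrightarrow> T \<subseteq> S \<and> (\<exists>c. (\<forall>t\<in>T. 0 \<le> c t) \<and> x = (\<Sum>t\<in>T. c t *\<^sub>R t))" for T
  have "P S"
  proof -
    obtain c where "\<And>s. s \<in> S \<Longrightarrow> 0 \<le> c s" "x = (\<Sum>s\<in>S. c s *\<^sub>R s)"
      by (rule convex_cone_hull_finite_sum[OF assms]) (rule that)
    then show ?thesis
      unfolding P_def by (intro conjI exI[of _ c]) auto
  qed
  then obtain T where T: "P T" and least: "\<And>T'. P T' \<Longrightarrow> card T \<le> card T'"
    using ex_has_least_nat[of P S card] by metis
  obtain c where c: "\<And>t. t \<in> T \<Longrightarrow> 0 \<le> c t" "x = (\<Sum>t\<in>T. c t *\<^sub>R t)" and TS: "T \<subseteq> S"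
    using T unfolding P_def by blast
  have finT: "finite T"
    using TS assms(1) finite_subset by blast
  have "independent T"
  proof
    assume "dependent T"
    then obtain w where w: "\<exists>t\<in>T. w t \<noteq> 0" "(\<Sum>t\<in>T. w t *\<^sub>R t) = 0"
      using dependent_finite[OF finT] by blast
    \<comment> \<open>A relation may be negated, so some coefficient can be taken positive.\<close>
    obtain d where d: "\<exists>t\<in>T. 0 < d t" "(\<Sum>t\<in>T. d t *\<^sub>R t) = 0"
    proof (cases "\<exists>t\<in>T. 0 < w t")
      case True
      then show ?thesis using that w by blast
    next
      case False
      then show ?thesis
        using that[of "\<lambda>t. - w t"] w by (force simp: sum_negf)
    qed
    define Q where "Q = {t \<in> T. 0 < d t}"
    have "finite Q" "Q \<noteq> {}"
      using finT d(1) by (auto simp: Q_def)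
    then obtain t0 where t0: "t0 \<in> Q" and min: "\<And>t. t \<in> Q \<Longrightarrow> c t0 / d t0 \<le> c t / d t"
      using arg_min_if_finite[of Q "\<lambda>t. c t / d t"] by (metis not_less)
    define r where "r = c t0 / d t0"
    have r0: "0 \<le> r"
      using t0 c(1) by (auto simp: r_def Q_def)
    have nonneg: "0 \<le> c t - r * d t" if "t \<in> T" for t
    proof (cases "0 < d t")
      case True
      then have "r \<le> c t / d t"
        unfolding r_def using that by (intro min) (simp add: Q_def)
      with True show ?thesis
        by (simp add: pos_le_divide_eq)
    next
      case False
      then show ?thesis
        using mult_nonneg_nonpos[OF r0, of "d t"] c(1)[OF that] by simp
    qed
    have t0T: "t0 \<in> T" and zero: "c t0 - r * d t0 = 0"
      using t0 by (auto simp: Q_def r_def)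
    have "(\<Sum>t\<in>T. (r * d t) *\<^sub>R t) = r *\<^sub>R (\<Sum>t\<in>T. d t *\<^sub>R t)"
      by (simp add: scaleR_sum_right)
    then have "x = (\<Sum>t\<in>T. (c t - r * d t) *\<^sub>R t)"
      using c(2) d(2) by (simp add: scaleR_diff_left sum_subtractf)
    also have "\<dots> = (\<Sum>t\<in>T - {t0}. (c t - r * d t) *\<^sub>R t)"
      using sum.remove[OF finT t0T, of "\<lambda>t. (c t - r * d t) *\<^sub>R t"] zero by simp
    finally have "P (T - {t0})"
      unfolding P_def using TS nonneg by (intro conjI exI[of _ "\<lambda>t. c t - r * d t"]) auto
    then show False
      using least[of "T - {t0}"] card_Diff1_less[OF finT t0T] by simp
  qed
  then show ?thesis
    using that TS c by blast
qed

section \<open>First-order conditions at a lower-level solution\<close>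

text \<open>
  This is Farkas' lemma; it rests on the closedness of finitely generated cones.
\<close>

lemma convex_cone_hull_separation:
  fixes S :: "'a::euclidean_space set"
  assumes "finite S" "x \<notin> convex_cone hull S"
  obtains d where "\<And>s. s \<in> S \<Longrightarrow> 0 \<le> s \<bullet> d" "x \<bullet> d < 0"
proof -
  obtain d k where dk: "d \<bullet> x < k" "\<And>z. z \<in> convex_cone hull S \<Longrightarrow> k < d \<bullet> z"
    using separating_hyperplane_closed_point[OF convex_convex_cone_hull closed_convex_cone_hull assms(2)]
      assms(1) by blast
  have k: "k < 0"
    using dk(2)[OF convex_cone_hull_contains_0] by simp
  have "0 \<le> s \<bullet> d" if "s \<in> S" for s
  proof (rule ccontr)
    assume neg: "\<not> 0 \<le> s \<bullet> d"
    \<comment> \<open>The multiple of \<open>s\<close> at which the linear functional takes the value \<open>k\<close>.\<close>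
    have "(k / (s \<bullet> d)) *\<^sub>R s \<in> convex_cone hull S"
      using neg k that by (intro convex_cone_hull_mul hull_inc) (auto simp: divide_nonpos_nonpos)
    then have "k < d \<bullet> ((k / (s \<bullet> d)) *\<^sub>R s)"
      by (rule dk(2))
    then show False
      using neg by (simp add: inner_commute)
  qed
  moreover have "x \<bullet> d < 0"
    using dk(1) k by (simp add: inner_commute)
  ultimately show ?thesis
    by (rule that)
qed

lemma lower_feasible_iff:
  "y \<in> lower_feasible A b x \<longleftrightarrow> (\<forall>j. 0 \<le> row j A \<bullet> y - b x $ j)"
  by (simp add: lower_feasible_def less_eq_vec_def matrix_vector_mul_component row_def vec_lambda_eta)

lemma GDERIV_grad_y:
  fixes f :: "(real^'n) \<times> (real^'p) \<Rightarrow> real"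
  assumes "f differentiable (at (x, y))"
  shows "GDERIV (\<lambda>v. f (x, v)) y :> grad_y f x y"
proof -
  obtain f' where f': "(f has_derivative f') (at (x, y))"
    using assms differentiable_def by blast
  have "((\<lambda>v. f (x, v)) has_derivative (\<lambda>h. f' (0, h))) (at y)"
    by (rule has_derivative_compose[where f = "\<lambda>v. (x, v)", OF _ f'])
      (auto intro!: derivative_eq_intros)
  moreover define g where "g = (\<lambda>h. f' (0, h))"
  ultimately have g: "((\<lambda>v. f (x, v)) has_derivative g) (at y)"
    by simp
  have "g = (\<lambda>h. h \<bullet> adjoint g 1)"
    using adjoint_works[OF has_derivative_linear[OF g], of _ 1] by auto
  with g have ex: "GDERIV (\<lambda>v. f (x, v)) y :> adjoint g 1"
    unfolding gderiv_def by metis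
  moreover have "D = adjoint g 1" if "GDERIV (\<lambda>v. f (x, v)) y :> D" for D
    using has_derivative_unique[OF that[unfolded gderiv_def] ex[unfolded gderiv_def]]
    by (metis inner_commute vector_eq_rdot)
  ultimately show ?thesis
    unfolding grad_y_def by (rule theI)
qed

text \<open>
  Along a direction that no active constraint opposes, a short segment stays feasible, so it cannot be
  a descent direction.
\<close>

lemma lower_solution_no_descent_direction:
  fixes A :: "real^'p^'m"
  assumes sol: "y \<in> lower_solutions f A b x"
    and D: "GDERIV (\<lambda>v. f (x, v)) y :> D"
    and d: "\<And>j. j \<in> active_set A b x y \<Longrightarrow> 0 \<le> row j A \<bullet> d"
  shows "0 \<le> D \<bullet> d"
proof (rule ccontr)
  assume neg: "\<not> 0 \<le> D \<bullet> d"
  have feas: "\<And>j. 0 \<le> row j A \<bullet> y - b x $ j"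
    and min: "\<And>v. v \<in> lower_feasible A b x \<Longrightarrow> f (x, y) \<le> f (x, v)"
    using sol by (auto simp: lower_solutions_def is_arg_min_def lower_feasible_iff not_less)
  have D': "((\<lambda>v. f (x, v)) has_derivative (\<lambda>h. h \<bullet> D)) (at (y + 0 *\<^sub>R d))"
    using D by (simp add: gderiv_def)
  have "((\<lambda>t. y + t *\<^sub>R d) has_derivative (\<lambda>t. t *\<^sub>R d)) (at 0)"
    by (auto intro!: derivative_eq_intros)
  from has_derivative_compose[OF this D']
  have "((\<lambda>t. f (x, y + t *\<^sub>R d)) has_real_derivative D \<bullet> d) (at 0)"
    by (simp add: has_field_derivative_def mult_commute_abs inner_commute)
  then obtain e where e: "e > 0" "\<And>t. 0 < t \<Longrightarrow> t < e \<Longrightarrow> f (x, y + t *\<^sub>R d) < f (x, y)"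
    using DERIV_neg_dec_right[of "\<lambda>t. f (x, y + t *\<^sub>R d)" "D \<bullet> d" 0] neg by auto
  have "\<forall>\<^sub>F t in at_right 0. 0 \<le> row j A \<bullet> (y + t *\<^sub>R d) - b x $ j" for j
  proof (cases "j \<in> active_set A b x y")
    case True
    then have "0 \<le> row j A \<bullet> (y + t *\<^sub>R d) - b x $ j" if "t > 0" for t
      using d that by (simp add: active_set_def inner_add_right)
    then show ?thesis
      by (intro eventually_mono[OF eventually_at_right_less])
  next
    case False
    then have "0 < row j A \<bullet> y - b x $ j"
      using feas[of j] by (simp add: active_set_def less_le)
    moreover have "((\<lambda>t. row j A \<bullet> (y + t *\<^sub>R d) - b x $ j) \<longlongrightarrow> row j A \<bullet> (y + 0 *\<^sub>R d) - b x $ j)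
        (at_right 0)"
      by (intro tendsto_intros)
    ultimately have "\<forall>\<^sub>F t in at_right 0. 0 < row j A \<bullet> (y + t *\<^sub>R d) - b x $ j"
      by (intro order_tendstoD(1)) auto
    then show ?thesis
      by (rule eventually_mono) simp
  qed
  then have "\<forall>\<^sub>F t in at_right 0. \<forall>j. 0 \<le> row j A \<bullet> (y + t *\<^sub>R d) - b x $ j"
    by (rule eventually_all_finite)
  moreover have "\<forall>\<^sub>F t in at_right 0. 0 < t \<and> t < e"
    using e(1) by (auto simp: eventually_at_right_field)
  ultimately have "\<forall>\<^sub>F t in at_right (0::real). False"
  proof eventually_elim
    case (elim t)
    then show False
      using e(2)[of t] min[of "y + t *\<^sub>R d"] by (simp add: lower_feasible_iff)
  qed
  then show False
    by simp
qed

lemma gradient_in_active_cone: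
  fixes A :: "real^'p^'m"
  assumes "y \<in> lower_solutions f A b x" "f differentiable (at (x, y))"
  shows "grad_y f x y \<in> convex_cone hull ((\<lambda>j. row j A) ` active_set A b x y)"
proof (rule ccontr)
  assume "\<not> ?thesis"
  then obtain d where d: "\<And>s. s \<in> (\<lambda>j. row j A) ` active_set A b x y \<Longrightarrow> 0 \<le> s \<bullet> d"
      "grad_y f x y \<bullet> d < 0"
    using convex_cone_hull_separation[OF finite_imageI[OF finite]] by blast
  have "0 \<le> grad_y f x y \<bullet> d"
    using lower_solution_no_descent_direction[OF assms(1) GDERIV_grad_y[OF assms(2)]] d(1) by blast
  with d(2) show False
    by simp
qed

section \<open>Feasible points lie in branch sets\<close>

text \<open>
  Since rows may coincide, the extension has to be a set of indices. A set of new vectors is chosen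
  first and then lifted injectively, which leaves the given indices untouched.
\<close>

lemma independent_family_extend:
  fixes a :: "'i \<Rightarrow> 'a::real_vector"
  assumes "J0 \<subseteq> K" "inj_on a J0" "independent (a ` J0)"
  obtains J where "J0 \<subseteq> J" "J \<subseteq> K" "inj_on a J" "independent (a ` J)" "a ` K \<subseteq> span (a ` J)"
proof -
  obtain B where B: "a ` J0 \<subseteq> B" "B \<subseteq> a ` K" "independent B" "a ` K \<subseteq> span B"
    using maximal_independent_subset_extend[of "a ` J0" "a ` K"] assms by blast
  have "B - a ` J0 \<subseteq> a ` K"
    using B by blast
  then obtain J1 where J1: "J1 \<subseteq> K" "inj_on a J1" "B - a ` J0 = a ` J1"
    unfolding subset_image_inj by blast
  have img: "a ` (J0 \<union> J1) = B"
    using B(1) J1(3) by blast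
  have "inj_on a (J0 \<union> J1)"
    using assms(2) J1(2,3) by (auto simp: inj_on_Un)
  with that[of "J0 \<union> J1"] img B J1 assms(1) show ?thesis
    by simp
qed

lemma rank_eq_dim_range_row: "rank A = dim (range (\<lambda>j. row j A))" for A :: "real^'p^'m"
  by (simp add: row_rank_def rows_def full_SetCompr_eq)

lemma row_basesI:
  fixes A :: "real^'p^'m"
  assumes "inj_on (\<lambda>j. row j A) J" "independent ((\<lambda>j. row j A) ` J)"
    and "card J = rank A"
  shows "J \<in> row_bases A"
proof -
  have "dim ((\<lambda>j. row j A) ` J) = card J"
    using assms by (simp add: dim_eq_card_independent card_image)
  then show ?thesis
    using assms(3) rank_bound[of A]
    by (simp add: row_bases_def row_submatrix_rank_def Setcompr_eq_image)
qed

lemma row_bases_dim: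
  fixes A :: "real^'p^'m"
  assumes "J \<in> row_bases A"
  shows "dim ((\<lambda>j. row j A) ` J) = rank A"
  using assms rank_bound[of A]
  by (simp add: row_bases_def row_submatrix_rank_def Setcompr_eq_image)

lemma bilevel_feasible_in_branch:
  fixes A :: "real^'p^'m"
  assumes feas: "(x, y) \<in> bilevel_feasible I1 h f A b"
    and diff: "f differentiable (at (x, y))"
    and active: "active_set A b x y \<subseteq> K"
    and full: "dim ((\<lambda>j. row j A) ` K) = rank A"
  obtains J where "J \<in> row_bases A" "J \<subseteq> K" "(x, y) \<in> branch_set I1 h f A b J"
proof -
  let ?a = "\<lambda>j. row j A"
  have U: "(x, y) \<in> constraint_set I1 h A b" and sol: "y \<in> lower_solutions f A b x"
    using feas by (auto simp: bilevel_feasible_def)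
  obtain T c where T: "T \<subseteq> ?a ` active_set A b x y" "independent T"
      "\<And>t. t \<in> T \<Longrightarrow> 0 \<le> c t" "grad_y f x y = (\<Sum>t\<in>T. c t *\<^sub>R t)"
    using convex_cone_hull_caratheodory[OF _ gradient_in_active_cone[OF sol diff]] by auto
  \<comment> \<open>Lift \<open>T\<close> to active indices: an inactive constraint may have the same row as an active one.\<close>
  obtain J0 where J0: "J0 \<subseteq> active_set A b x y" "inj_on ?a J0" "T = ?a ` J0"
    using T(1) unfolding subset_image_inj by blast
  obtain J where J: "J0 \<subseteq> J" "J \<subseteq> K" "inj_on ?a J" "independent (?a ` J)"
      "?a ` K \<subseteq> span (?a ` J)"
    using independent_family_extend[of J0 K ?a] J0 T(2) active by (metis subset_trans)
  have "card J = dim (?a ` J)"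
    using J by (simp add: dim_eq_card_independent card_image)
  also have "\<dots> = dim (?a ` K)"
  proof (rule antisym)
    show "dim (?a ` J) \<le> dim (?a ` K)"
      using J(2) by (intro dim_subset image_mono)
    show "dim (?a ` K) \<le> dim (?a ` J)"
      using dim_subset[OF J(5)] by simp
  qed
  finally have "J \<in> row_bases A"
    using row_basesI[OF J(3,4)] full by simp
  moreover have "(x, y) \<in> branch_set I1 h f A b J"
  proof -
    define l where "l j = (if j \<in> J0 then c (?a j) else 0)" for j
    have "grad_y f x y = (\<Sum>j\<in>J0. c (?a j) *\<^sub>R ?a j)"
      using T(4) J0 by (simp add: sum.reindex)
    also have "\<dots> = (\<Sum>j\<in>J. l j *\<^sub>R ?a j)"
      using J(1) by (intro sum.mono_neutral_cong_left) (auto simp: l_def)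
    finally have "grad_y f x y - (\<Sum>j\<in>J. l j *\<^sub>R ?a j) = 0"
      by simp
    moreover have "0 \<le> l j" "l j * (?a j \<bullet> y - b x $ j) = 0" for j
      using T(3) J0 by (auto simp: l_def active_set_def)
    moreover have "0 \<le> ?a j \<bullet> y - b x $ j" for j
      using U by (auto simp: constraint_set_def)
    ultimately show ?thesis
      using U by (auto simp: branch_set_def intro!: exI[of _ l])
  qed
  ultimately show ?thesis
    using that J(2) by blast
qed

section \<open>Locality of the active set and optimality\<close>

lemma eventually_active_set_subset:
  fixes A :: "real^'p^'m" and b :: "real^'n \<Rightarrow> real^'m"
  assumes "\<And>j. isCont (\<lambda>x. b x $ j) u"
  shows "\<forall>\<^sub>F z in nhds (u, v). active_set A b (fst z) (snd z) \<subseteq> active_set A b u v"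
proof -
  have "\<forall>\<^sub>F z in nhds (u, v). j \<in> active_set A b (fst z) (snd z) \<longrightarrow> j \<in> active_set A b u v" for j
  proof (cases "j \<in> active_set A b u v")
    case False
    have fst: "(fst \<longlongrightarrow> u) (nhds (u, v))" and snd: "(snd \<longlongrightarrow> v) (nhds (u, v))"
      using tendsto_fst[OF filterlim_ident[of "nhds (u, v)"]]
        tendsto_snd[OF filterlim_ident[of "nhds (u, v)"]] by simp_all
    have "((\<lambda>z. row j A \<bullet> snd z - b (fst z) $ j) \<longlongrightarrow> row j A \<bullet> v - b u $ j) (nhds (u, v))"
      by (rule tendsto_diff[OF tendsto_inner[OF tendsto_const snd] isCont_tendsto_compose[OF assms fst]])
    then have "\<forall>\<^sub>F z in nhds (u, v). row j A \<bullet> snd z - b (fst z) $ j \<noteq> 0"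
      using False by (intro tendsto_imp_eventually_ne) (auto simp: active_set_def)
    then show ?thesis
      by (rule eventually_mono) (simp add: active_set_def)
  qed simp
  then have "\<forall>\<^sub>F z in nhds (u, v). \<forall>j. j \<in> active_set A b (fst z) (snd z) \<longrightarrow> j \<in> active_set A b u v"
    by (rule eventually_all_finite)
  then show ?thesis
    by (simp add: subset_iff)
qed

text \<open>
  Both parts of the theorem compare \<open>F (u, v)\<close> with \<open>F\<close> at a single feasible point; they differ only
  in the index set \<open>K\<close> from which the branches are taken.
\<close>

lemma branch_optimizer_le:
  fixes A :: "real^'p^'m"
  assumes opt: "global_optimizer F (branch_set I1 h f A b J) z0"
    and le: "\<And>J'. J' \<in> row_bases A \<Longrightarrow> J' \<subseteq> K \<Longrightarrow>
      branch_value F I1 h f A b J \<le> branch_value F I1 h f A b J'"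
    and J: "J \<in> row_bases A" "J \<subseteq> K"
    and z: "(x, y) \<in> bilevel_feasible I1 h f A b" "f differentiable (at (x, y))"
      "active_set A b x y \<subseteq> K"
  shows "F z0 \<le> F (x, y)"
proof -
  let ?a = "\<lambda>j. row j A"
  have "dim (?a ` J) \<le> dim (?a ` K)" "dim (?a ` K) \<le> dim (range ?a)"
    using J(2) by (auto intro!: dim_subset)
  then have "dim (?a ` K) = rank A"
    using row_bases_dim[OF J(1)] rank_eq_dim_range_row[of A] by simp
  then obtain J' where J': "J' \<in> row_bases A" "J' \<subseteq> K" "(x, y) \<in> branch_set I1 h f A b J'"
    using bilevel_feasible_in_branch[OF z] by blast
  have "ereal (F z0) \<le> branch_value F I1 h f A b J"
    using opt unfolding branch_value_def global_optimizer_def is_arg_min_def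
    by (intro INF_greatest) (auto simp: not_less)
  also have "\<dots> \<le> branch_value F I1 h f A b J'"
    using le J' by blast
  also have "\<dots> \<le> ereal (F (x, y))"
    unfolding branch_value_def using J'(3) by (rule INF_lower)
  finally show ?thesis
    by simp
qed

theorem theorem3p2:
  fixes F f :: "(real^'n) \<times> (real^'p) \<Rightarrow> real"
    and I1 :: "'i set"
    and h :: "'i \<Rightarrow> (real^'n) \<times> (real^'p) \<Rightarrow> real"
    and A :: "real^'p^'m"
    and b :: "real^'n \<Rightarrow> real^'m"
    and J :: "'m set"
    and u :: "real^'n"
    and v :: "real^'p"
  assumes "finite I1"
    and "real_polynomial_function F"
    and "real_polynomial_function f"
    and "\<And>i. i \<in> I1 \<Longrightarrow> real_polynomial_function (h i)"
    and "\<And>j. real_polynomial_function (\<lambda>x. b x $ j)"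
    and "\<And>x y. (x, y) \<in> constraint_set I1 h A b \<Longrightarrow> lower_solutions f A b x \<noteq> {}"
    and "J \<in> row_bases A"
    and "global_optimizer F (branch_set I1 h f A b J) (u, v)"
    and "(u, v) \<in> bilevel_feasible I1 h f A b"
  shows "((\<forall>J'\<in>row_bases A. J' \<subseteq> active_set A b u v \<union> J \<longrightarrow>
             branch_value F I1 h f A b J \<le> branch_value F I1 h f A b J') \<longrightarrow>
           local_optimizer F (bilevel_feasible I1 h f A b) (u, v)) \<and>
         ((\<forall>J'\<in>row_bases A.
             branch_value F I1 h f A b J \<le> branch_value F I1 h f A b J') \<longrightarrow>
           global_optimizer F (bilevel_feasible I1 h f A b) (u, v))"
proof -
  have diff: "f differentiable (at z)" for z
    using assms(3) by (rule differentiable_at_real_polynomial_function)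
  have cont: "isCont (\<lambda>x. b x $ j) u" for j
    using assms(5) by (rule continuous_real_polymonial_function)
  note le = branch_optimizer_le[OF assms(8)]
  show ?thesis
  proof (intro conjI impI)
    assume loc: "\<forall>J'\<in>row_bases A. J' \<subseteq> active_set A b u v \<union> J \<longrightarrow>
      branch_value F I1 h f A b J \<le> branch_value F I1 h f A b J'"
    obtain r where r: "r > 0"
        "\<And>z. dist z (u, v) < r \<Longrightarrow> active_set A b (fst z) (snd z) \<subseteq> active_set A b u v"
      using eventually_active_set_subset[OF cont, where A = A and v = v]
      unfolding eventually_nhds_metric by blast
    have "F (u, v) \<le> F (x, y)"
      if "(x, y) \<in> bilevel_feasible I1 h f A b" "(x, y) \<in> ball (u, v) r" for x y
      using le[where K = "active_set A b u v \<union> J", OF _ assms(7) _ that(1) diff]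
        loc r(2)[of "(x, y)"] that(2) by (auto simp: dist_commute)
    then show "local_optimizer F (bilevel_feasible I1 h f A b) (u, v)"
      unfolding local_optimizer_def global_optimizer_def is_arg_min_def
      using assms(9) r(1) by (intro exI[of _ r]) (force simp: not_less)
  next
    assume glob: "\<forall>J'\<in>row_bases A. branch_value F I1 h f A b J \<le> branch_value F I1 h f A b J'"
    have "F (u, v) \<le> F (x, y)" if "(x, y) \<in> bilevel_feasible I1 h f A b" for x y
      using le[where K = UNIV, OF _ assms(7) _ that diff] glob by auto
    then show "global_optimizer F (bilevel_feasible I1 h f A b) (u, v)"
      unfolding global_optimizer_def is_arg_min_def using assms(9) by (auto simp: not_less)
  qed
qed

end
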